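(* Every divisive meadow with a finite carrier admits transformation into simple fractions.
   Context: Let $\Sigma$ be the signature with constants $0,1$, binary operators $+$, $\cdot$, $/$ and unary operator $-$. Terms over $\Sigma$ are built as usual from infinitely many variables. A divisive meadow is a total algebra over $\Sigma$ satisfying the set $E$ of the following equations: $(x+y)+z=x+(y+z)$, $x+y=y+x$, $x+0=x$, $x+(-x)=0$, $(x\cdot y)\cdot z=x\cdot(y\cdot z)$, $x\cdot y=y\cdot x$, $x\cdot 1=x$, $x\cdot(y+z)=x\cdot y+x\cdot z$, $1/(1/x)=x$, $(x\cdot x)/x=x$, $x/y=x\cdot(1/y)$. A fraction is a term over $\Sigma$ whose outermost operator is $/$. A simple fraction is a fraction of which no proper subterm is a fraction. A divisive meadow $M$ admits transformation into simple fractions if, for each term $p$ over $\Sigma$, there exists a simple fraction $q$ such that $M\models p=q$. *)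

theory Defs
  imports "HOL-Algebra.Ring"
begin

datatype mterm =
    Var nat
  | Zero
  | One
  | Add mterm mterm
  | Mul mterm mterm
  | Div mterm mterm
  | Neg mterm

text \<open>
  The record extends the ring record only for its fields (carrier, multiplication, one, zero,
  addition); no ring axioms are attached to it. Negation is a separate operation of the
  signature, not the additive inverse derived from the ring structure.
\<close>

record 'a meadow_alg = "'a ring" +
  neg :: "'a \<Rightarrow> 'a"
  quot :: "'a \<Rightarrow> 'a \<Rightarrow> 'a"

definition total_algebra :: "('a, 'm) meadow_alg_scheme \<Rightarrow> bool" where
  "total_algebra M \<longleftrightarrow>
     \<zero>\<^bsub>M\<^esub> \<in> carrier M \<and>
     \<one>\<^bsub>M\<^esub> \<in> carrier M \<and>
     (\<forall>x \<in> carrier M. \<forall>y \<in> carrier M. x \<oplus>\<^bsub>M\<^esub> y \<in> carrier M) \<and>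
     (\<forall>x \<in> carrier M. \<forall>y \<in> carrier M. x \<otimes>\<^bsub>M\<^esub> y \<in> carrier M) \<and>
     (\<forall>x \<in> carrier M. \<forall>y \<in> carrier M. quot M x y \<in> carrier M) \<and>
     (\<forall>x \<in> carrier M. neg M x \<in> carrier M)"

primrec eval_term :: "('a, 'm) meadow_alg_scheme \<Rightarrow> (nat \<Rightarrow> 'a) \<Rightarrow> mterm \<Rightarrow> 'a" where
  "eval_term M \<rho> (Var i) = \<rho> i"
| "eval_term M \<rho> Zero = \<zero>\<^bsub>M\<^esub>"
| "eval_term M \<rho> One = \<one>\<^bsub>M\<^esub>"
| "eval_term M \<rho> (Add p q) = eval_term M \<rho> p \<oplus>\<^bsub>M\<^esub> eval_term M \<rho> q"
| "eval_term M \<rho> (Mul p q) = eval_term M \<rho> p \<otimes>\<^bsub>M\<^esub> eval_term M \<rho> q"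
| "eval_term M \<rho> (Div p q) = quot M (eval_term M \<rho> p) (eval_term M \<rho> q)"
| "eval_term M \<rho> (Neg p) = neg M (eval_term M \<rho> p)"

definition satisfies_eq :: "('a, 'm) meadow_alg_scheme \<Rightarrow> mterm \<Rightarrow> mterm \<Rightarrow> bool" where
  "satisfies_eq M p q \<longleftrightarrow>
     (\<forall>\<rho>. range \<rho> \<subseteq> carrier M \<longrightarrow> eval_term M \<rho> p = eval_term M \<rho> q)"

definition meadow_eqs :: "(mterm \<times> mterm) set" where
  "meadow_eqs =
     (let x = Var 0; y = Var 1; z = Var 2 in
      {(Add (Add x y) z, Add x (Add y z)),
       (Add x y, Add y x),
       (Add x Zero, x),
       (Add x (Neg x), Zero),
       (Mul (Mul x y) z, Mul x (Mul y z)),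
       (Mul x y, Mul y x),
       (Mul x One, x),
       (Mul x (Add y z), Add (Mul x y) (Mul x z)),
       (Div One (Div One x), x),
       (Div (Mul x x) x, x),
       (Div x y, Mul x (Div One y))})"

definition divisive_meadow :: "('a, 'm) meadow_alg_scheme \<Rightarrow> bool" where
  "divisive_meadow M \<longleftrightarrow>
     total_algebra M \<and> (\<forall>(p, q) \<in> meadow_eqs. satisfies_eq M p q)"

definition is_fraction :: "mterm \<Rightarrow> bool" where
  "is_fraction t \<longleftrightarrow> (\<exists>p q. t = Div p q)"

primrec subterms :: "mterm \<Rightarrow> mterm set" where
  "subterms (Var i) = {Var i}"
| "subterms Zero = {Zero}"
| "subterms One = {One}"
| "subterms (Add p q) = insert (Add p q) (subterms p \<union> subterms q)"
| "subterms (Mul p q) = insert (Mul p q) (subterms p \<union> subterms q)"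
| "subterms (Div p q) = insert (Div p q) (subterms p \<union> subterms q)"
| "subterms (Neg p) = insert (Neg p) (subterms p)"

definition simple_fraction :: "mterm \<Rightarrow> bool" where
  "simple_fraction t \<longleftrightarrow>
     is_fraction t \<and> (\<forall>s \<in> subterms t. s \<noteq> t \<longrightarrow> \<not> is_fraction s)"

definition admits_simple_fractions :: "('a, 'm) meadow_alg_scheme \<Rightarrow> bool" where
  "admits_simple_fractions M \<longleftrightarrow>
     (\<forall>p. \<exists>q. simple_fraction q \<and> satisfies_eq M p q)"

end

theory Submission imports Defs begin

text \<open>
  In a finite meadow the inverse operation is a power function, with one exponent for all elements:
  by pigeonhole there are \<open>r < s\<close>, both even, such that \<open>x\<^sup>r = x\<^sup>s\<close> for all \<open>x\<close>, and cancelling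
  \<open>x\<^sup>r\<close> against \<open>(1/x)\<^sup>r\<close> gives \<open>1/x = x\<^bsup>s-r-1\<^esup>\<close>. Replacing every \<open>p/q\<close> by \<open>p \<cdot> q\<^sup>n\<close> then
  removes all divisions from a term, and dividing the result by \<open>1\<close> yields a simple fraction.
\<close>

text \<open>Serves to cancel a power of \<open>x\<close> against the same power of a weak inverse
  \<open>y\<close>: whatever absorbs \<open>x \<otimes> y\<close> absorbs its powers too.\<close>

lemma (in comm_monoid) absorb_pow_mult:
  assumes "x \<in> carrier G" "y \<in> carrier G" "c \<in> carrier G" "c \<otimes> (x \<otimes> y) = c"
  shows "c \<otimes> (x [^] (k::nat) \<otimes> y [^] k) = c"
proof -
  have "c \<otimes> (x \<otimes> y) [^] k = c"
  proof (induction k)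
    case (Suc k)
    then show ?case
      using assms by (simp flip: m_assoc)
  qed (use assms in simp)
  then show ?thesis
    using assms by (simp add: pow_mult_distrib m_comm)
qed

lemma (in comm_monoid) finite_weak_inverse_is_pow:
  assumes "finite (carrier G)"
  obtains n :: nat where
    "\<And>x y. \<lbrakk>x \<in> carrier G; y \<in> carrier G; x \<otimes> x \<otimes> y = x; y \<otimes> y \<otimes> x = y\<rbrakk> \<Longrightarrow> y = x [^] n"
proof -
  \<comment> \<open>Even exponents, so that the two colliding ones differ by at least \<open>2\<close>.\<close>
  define f where "f n = restrict (\<lambda>x. x [^] (2 * n)) (carrier G)" for n :: nat
  \<comment> \<open>Powers are compared as maps on the whole carrier, so the exponent will not
    depend on \<open>x\<close>; \<open>restrict\<close> makes these maps extensional, and there are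
    only finitely many such maps.\<close>
  have "range f \<subseteq> carrier G \<rightarrow>\<^sub>E carrier G"
    by (auto simp: f_def)
  moreover have "finite (carrier G \<rightarrow>\<^sub>E carrier G)"
    using assms by (simp add: finite_PiE)
  ultimately have "\<not> inj f"
    using finite_imageD finite_subset infinite_UNIV_nat by blast
  then obtain a b where "a < b" and f: "f a = f b"
    by (metis injI linorder_neqE_nat)
  \<comment> \<open>The colliding exponents differ by \<open>j + 2\<close>; the truncated
    subtraction is exact because \<open>a < b\<close>.\<close>
  define j where "j = 2 * (b - a - 1)"
  have j: "2 * b = Suc (Suc (j + 2 * a))"
    using \<open>a < b\<close> by (simp add: j_def)
  show thesis
  proof
    fix x y
    assume x: "x \<in> carrier G" and y: "y \<in> carrier G"
      and xxy: "x \<otimes> x \<otimes> y = x" and yyx: "y \<otimes> y \<otimes> x = y"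
    \<comment> \<open>\<open>w\<close> acts as an identity on \<open>x\<close> and on
      \<open>y\<close>, since both absorb \<open>x \<otimes> y\<close>.\<close>
    define w where "w = x [^] (2 * a) \<otimes> y [^] (2 * a)"
    have w: "w \<in> carrier G"
      using x y by (simp add: w_def)
    have "x [^] (2 * a) = x [^] (2 * b)"
      using fun_cong[OF f, of x] x by (simp add: f_def)
    also have "\<dots> = x \<otimes> x \<otimes> x [^] j \<otimes> x [^] (2 * a)"
      unfolding j using x by (simp add: m_ac flip: nat_pow_mult)
    finally have pow: "x [^] (2 * a) = x \<otimes> x \<otimes> x [^] j \<otimes> x [^] (2 * a)" .
    have "y = y \<otimes> w"
      unfolding w_def using absorb_pow_mult[of x y y] x y yyx by (simp add: m_ac)
    \<comment> \<open>The left side of \<open>pow\<close> recurs on its right, so it is unfolded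
      just once; the two extra factors \<open>x\<close> then swallow the leading
      \<open>y\<close>.\<close>
    also have "\<dots> = y \<otimes> (x \<otimes> x \<otimes> x [^] j \<otimes> x [^] (2 * a) \<otimes> y [^] (2 * a))"
      unfolding w_def by (subst pow) (rule refl)
    also have "\<dots> = (x \<otimes> x \<otimes> y) \<otimes> x [^] j \<otimes> w"
      unfolding w_def using x y by (simp add: m_ac)
    also have "\<dots> = x [^] j \<otimes> (x \<otimes> w)"
      using x w by (simp add: xxy m_ac)
    also have "x \<otimes> w = x"
      unfolding w_def using absorb_pow_mult[of x y x] x y xxy by (simp add: m_ac)
    finally show "y = x [^] Suc j"
      by simp
  qed
qed

lemma total_algebra_eval_closed:
  assumes "total_algebra M" "range \<rho> \<subseteq> carrier M"
  shows "eval_term M \<rho> t \<in> carrier M"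
  using assms by (induction t) (auto simp: total_algebra_def)

text \<open>The axioms use variables 0, 1 and 2, but an assignment must send every variable into the
  carrier; the others get \<open>z\<close>.\<close>

lemma satisfies_eqD3:
  assumes "satisfies_eq M p q" "x \<in> carrier M" "y \<in> carrier M" "z \<in> carrier M"
  shows "eval_term M (\<lambda>i. if i = 0 then x else if i = 1 then y else z) p =
         eval_term M (\<lambda>i. if i = 0 then x else if i = 1 then y else z) q"
  using assms unfolding satisfies_eq_def by (simp add: image_subset_iff)

lemma divisive_meadow_comm_monoid:
  assumes "divisive_meadow M"
  shows "comm_monoid M"
proof (rule comm_monoidI)
  have eqs: "\<forall>(p, q) \<in> meadow_eqs. satisfies_eq M p q" and M: "total_algebra M"
    using assms by (auto simp: divisive_meadow_def)
  note E = eqs[unfolded meadow_eqs_def Let_def, simplified]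
  show one: "\<one>\<^bsub>M\<^esub> \<in> carrier M"
    using M by (simp add: total_algebra_def)
  show "x \<otimes>\<^bsub>M\<^esub> y \<in> carrier M" if "x \<in> carrier M" "y \<in> carrier M" for x y
    using M that by (simp add: total_algebra_def)
  show "x \<otimes>\<^bsub>M\<^esub> y \<otimes>\<^bsub>M\<^esub> z = x \<otimes>\<^bsub>M\<^esub> (y \<otimes>\<^bsub>M\<^esub> z)"
    if "x \<in> carrier M" "y \<in> carrier M" "z \<in> carrier M" for x y z
    using satisfies_eqD3[of M "Mul (Mul (Var 0) (Var 1)) (Var 2)"
        "Mul (Var 0) (Mul (Var 1) (Var 2))" x y z] E that by simp
  show comm: "x \<otimes>\<^bsub>M\<^esub> y = y \<otimes>\<^bsub>M\<^esub> x" if "x \<in> carrier M" "y \<in> carrier M" for x y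
    using satisfies_eqD3[of M "Mul (Var 0) (Var 1)" "Mul (Var 1) (Var 0)" x y x] E that by simp
  show "\<one>\<^bsub>M\<^esub> \<otimes>\<^bsub>M\<^esub> x = x" if "x \<in> carrier M" for x
    using satisfies_eqD3[of M "Mul (Var 0) One" "Var 0" x x x] E that comm[OF one that] by simp
qed

lemma divisive_meadow_quot:
  assumes "divisive_meadow M" "x \<in> carrier M" "y \<in> carrier M"
  shows "quot M \<one>\<^bsub>M\<^esub> (quot M \<one>\<^bsub>M\<^esub> x) = x"
    and "quot M (x \<otimes>\<^bsub>M\<^esub> x) x = x"
    and "quot M x y = x \<otimes>\<^bsub>M\<^esub> quot M \<one>\<^bsub>M\<^esub> y"
proof -
  have eqs: "\<forall>(p, q) \<in> meadow_eqs. satisfies_eq M p q"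
    using assms by (auto simp: divisive_meadow_def)
  note E = eqs[unfolded meadow_eqs_def Let_def, simplified]
  show "quot M \<one>\<^bsub>M\<^esub> (quot M \<one>\<^bsub>M\<^esub> x) = x"
    using satisfies_eqD3[of M "Div One (Div One (Var 0))" "Var 0" x x x] E assms by simp
  show "quot M (x \<otimes>\<^bsub>M\<^esub> x) x = x"
    using satisfies_eqD3[of M "Div (Mul (Var 0) (Var 0)) (Var 0)" "Var 0" x x x] E assms by simp
  show "quot M x y = x \<otimes>\<^bsub>M\<^esub> quot M \<one>\<^bsub>M\<^esub> y"
    using satisfies_eqD3[of M "Div (Var 0) (Var 1)" "Mul (Var 0) (Div One (Var 1))" x y x] E assms
    by simp
qed

text \<open>The law \<open>(x \<cdot> x)/x = x\<close> at 1 yields \<open>1/1 = 1\<close>. Hence a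
  division-free term can be wrapped in a fraction with its value kept.\<close>

lemma divisive_meadow_quot_one:
  assumes "divisive_meadow M" "x \<in> carrier M"
  shows "quot M x \<one>\<^bsub>M\<^esub> = x"
proof -
  interpret comm_monoid M
    using assms(1) by (rule divisive_meadow_comm_monoid)
  show ?thesis
    using divisive_meadow_quot(2)[OF assms(1) one_closed one_closed]
      divisive_meadow_quot(3)[OF assms one_closed] assms(2) by simp
qed

lemma finite_divisive_meadow_quot_is_pow:
  assumes M: "divisive_meadow M" and "finite (carrier M)"
  obtains n :: nat where
    "\<And>x y. \<lbrakk>x \<in> carrier M; y \<in> carrier M\<rbrakk> \<Longrightarrow> quot M x y = x \<otimes>\<^bsub>M\<^esub> y [^]\<^bsub>M\<^esub> n"
proof -
  interpret comm_monoid M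
    using M by (rule divisive_meadow_comm_monoid)
  obtain n :: nat where n: "\<And>x y. \<lbrakk>x \<in> carrier M; y \<in> carrier M; x \<otimes>\<^bsub>M\<^esub> x \<otimes>\<^bsub>M\<^esub> y = x;
      y \<otimes>\<^bsub>M\<^esub> y \<otimes>\<^bsub>M\<^esub> x = y\<rbrakk> \<Longrightarrow> y = x [^]\<^bsub>M\<^esub> n"
    using finite_weak_inverse_is_pow[OF assms(2)] by blast
  show thesis
  proof
    fix x y
    assume x: "x \<in> carrier M" and y: "y \<in> carrier M"
    define i where "i = quot M \<one>\<^bsub>M\<^esub> y"
    have i: "i \<in> carrier M"
      using M y by (auto simp: i_def divisive_meadow_def total_algebra_def)
    have inv: "z \<otimes>\<^bsub>M\<^esub> z \<otimes>\<^bsub>M\<^esub> quot M \<one>\<^bsub>M\<^esub> z = z" if "z \<in> carrier M" for z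
      using divisive_meadow_quot(2,3)[OF M, of z z]
        divisive_meadow_quot(3)[OF M, of "z \<otimes>\<^bsub>M\<^esub> z" z] that by simp
    have "i = y [^]\<^bsub>M\<^esub> n"
    proof (rule n[OF y i])
      show "y \<otimes>\<^bsub>M\<^esub> y \<otimes>\<^bsub>M\<^esub> i = y"
        using inv[OF y] by (simp add: i_def)
      \<comment> \<open>The same law at \<open>i\<close>, whose own inverse is \<open>y\<close> by
        involution.\<close>
      show "i \<otimes>\<^bsub>M\<^esub> i \<otimes>\<^bsub>M\<^esub> y = i"
        using inv[OF i] divisive_meadow_quot(1)[OF M y y] by (simp add: i_def)
    qed
    then show "quot M x y = x \<otimes>\<^bsub>M\<^esub> y [^]\<^bsub>M\<^esub> n"
      using divisive_meadow_quot(3)[OF M x y] by (simp add: i_def)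
  qed
qed

text \<open>The recursion copies that of \<open>[^]\<close>, including the side of the new factor,
  so evaluation commutes with it without any laws on \<open>M\<close>.\<close>

primrec term_pow :: "mterm \<Rightarrow> nat \<Rightarrow> mterm" where
  "term_pow t 0 = One"
| "term_pow t (Suc n) = Mul (term_pow t n) t"

lemma eval_term_pow: "eval_term M \<rho> (term_pow t n) = eval_term M \<rho> t [^]\<^bsub>M\<^esub> n"
  by (induction n) simp_all

primrec elim_div :: "nat \<Rightarrow> mterm \<Rightarrow> mterm" where
  "elim_div n (Var i) = Var i"
| "elim_div n Zero = Zero"
| "elim_div n One = One"
| "elim_div n (Add p q) = Add (elim_div n p) (elim_div n q)"
| "elim_div n (Mul p q) = Mul (elim_div n p) (elim_div n q)"
| "elim_div n (Div p q) = Mul (elim_div n p) (term_pow (elim_div n q) n)"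
| "elim_div n (Neg p) = Neg (elim_div n p)"

lemma term_pow_no_fraction:
  assumes "\<forall>s \<in> subterms t. \<not> is_fraction s"
  shows "\<forall>s \<in> subterms (term_pow t n). \<not> is_fraction s"
  using assms by (induction n) (auto simp: is_fraction_def)

text \<open>The term itself is among its subterms, so after one outer \<open>Div\<close> is added,
  that is the only fraction.\<close>

lemma elim_div_no_fraction: "\<forall>s \<in> subterms (elim_div n t). \<not> is_fraction s"
proof (induction t)
  case (Div p q)
  then show ?case
    using term_pow_no_fraction[of "elim_div n q" n] by (auto simp: is_fraction_def)
qed (auto simp: is_fraction_def)

text \<open>Division is known to be a power on the carrier only, so the induction needs the values
  of all subterms to lie there.\<close>

lemma eval_elim_div:
  assumes "total_algebra M" "range \<rho> \<subseteq> carrier M"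
    and "\<And>x y. \<lbrakk>x \<in> carrier M; y \<in> carrier M\<rbrakk> \<Longrightarrow> quot M x y = x \<otimes>\<^bsub>M\<^esub> y [^]\<^bsub>M\<^esub> n"
  shows "eval_term M \<rho> (elim_div n t) = eval_term M \<rho> t"
  using assms(3) total_algebra_eval_closed[OF assms(1,2)]
  by (induction t) (simp_all add: eval_term_pow)

theorem theorem7:
  fixes M :: "('a, 'm) meadow_alg_scheme"
  assumes "divisive_meadow M"
    and "finite (carrier M)"
  shows "admits_simple_fractions M"
proof -
  obtain n :: nat where
    n: "\<And>x y. \<lbrakk>x \<in> carrier M; y \<in> carrier M\<rbrakk> \<Longrightarrow> quot M x y = x \<otimes>\<^bsub>M\<^esub> y [^]\<^bsub>M\<^esub> n"
    using finite_divisive_meadow_quot_is_pow[OF assms] by blast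
  have M: "total_algebra M"
    using assms(1) by (simp add: divisive_meadow_def)
  \<comment> \<open>As \<open>n\<close> fits all denominators at once, the witness does not depend
    on the assignment.\<close>
  have "simple_fraction (Div (elim_div n p) One)" for p
    using elim_div_no_fraction[of n p] by (auto simp: simple_fraction_def is_fraction_def)
  moreover have "satisfies_eq M p (Div (elim_div n p) One)" for p
    unfolding satisfies_eq_def
    using eval_elim_div[OF M _ n] total_algebra_eval_closed[OF M]
      divisive_meadow_quot_one[OF assms(1)] by simp
  ultimately show ?thesis
    unfolding admits_simple_fractions_def by blast
qed

end
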